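(* Let $Y$ be a metric space and let $M\subseteq Y$ be a closed subset homeomorphic to the cylinder $\mathcal{C}:=[a,b]\times A$, where $A$ is an absolute retract and $a,b\in\mathbb{R}$ with $a<b$. Let $h\colon M\to[a,b]\times A$ be a homeomorphism (onto $[a,b]\times A$), and set $$M_l:=h^{-1}(\{a\}\times A),\qquad M_r:=h^{-1}(\{b\}\times A).$$ Let $N\subseteq Y$, let $\phi\colon N\to Y$ be a map, and suppose that there exists a closed set $V\subseteq M\cap N$ such that (i) $\phi$ is compact on $V$; (ii) for every path $\sigma\subseteq M$ with $\sigma\cap M_l\neq\emptyset$ and $\sigma\cap M_r\neq\emptyset$ there exists a sub-path $\gamma\subseteq\sigma\cap V$ with $\phi(\gamma)\subseteq M$, $\phi(\gamma)\cap M_l\neq\emptyset$ and $\phi(\gamma)\cap M_r\neq\emptyset$. Then there exists $\tilde z\in V$ such that $\phi(\tilde z)=\tilde z$.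
   Context: A space $A$ is an absolute retract (AR) if $A$ is metrizable and, for every metrizable space $Z$ and every closed $F\subseteq Z$, each continuous function $f\colon F\to A$ extends continuously over $Z$. A map between metric spaces is compact if it is continuous and the closure of its image is a compact subset of the target space; "$\phi$ is compact on $V$" means that the restriction $\phi|_V$ is compact. No continuity of $\phi$ outside $V$ is assumed. "Closed" means closed in $Y$. A path is a continuous map $\sigma$ from a compact interval $I\subseteq\mathbb{R}$ (usually $I=[0,1]$) into $Y$; its support is $\sigma(I)$. A sub-path of $\sigma$ is a restriction $\gamma=\sigma|_{[s_0,s_1]}$ with $[s_0,s_1]\subseteq I$. In set-theoretic expressions a path denotes its support: for a set $Z$, $\sigma\subseteq Z$ means $\sigma(I)\subseteq Z$, $\sigma\cap Z\neq\emptyset$ means $\sigma(I)\cap Z\neq\emptyset$, and $\phi(\gamma)$ is the image under $\phi$ of the support of $\gamma$. "A sub-path $\gamma\subseteq\sigma\cap V$" means a sub-path $\gamma$ of $\sigma$ whose support is contained in $V$. *)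

theory Defs
  imports "HOL-Analysis.Analysis"
begin

text \<open>
  The spaces \<open>Z\<close> in the definition of an absolute retract would range over all metrizable
  spaces; HOL does not quantify over types, so they range over the metrizable topologies whose
  points are functions \<open>'a \<Rightarrow> real\<close>. This loses nothing: it is formally implied by the unrestricted
  property, and conversely a metrizable \<open>A\<close> is homeomorphic to a closed subset of a convex set
  of bounded functions \<open>'a \<Rightarrow> real\<close> with the sup metric (Kuratowski, Wojdyslawski). Taking that
  convex set for \<open>Z\<close> makes \<open>A\<close> homeomorphic to a retract of it, and then Dugundji's extension
  theorem gives the extension property of \<open>A\<close> for all metrizable spaces. The library predicate
  \<open>AR\<close> is not used because it only concerns subsets of Euclidean spaces.
\<close>

definition absolute_retract :: "'a topology \<Rightarrow> bool" where
  "absolute_retract A \<longleftrightarrow>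
     metrizable_space A \<and>
     (\<forall>(Z :: ('a \<Rightarrow> real) topology) F f.
        metrizable_space Z \<and> closedin Z F \<and> continuous_map (subtopology Z F) A f \<longrightarrow>
        (\<exists>g. continuous_map Z A g \<and> (\<forall>x\<in>F. g x = f x)))"

definition compact_map_on ::
    "'x::topological_space set \<Rightarrow> ('x \<Rightarrow> 'y::topological_space) \<Rightarrow> bool" where
  "compact_map_on V \<phi> \<longleftrightarrow> continuous_on V \<phi> \<and> compact (closure (\<phi> ` V))"

end

theory Submission
  imports Defs
begin

text \<open>
  A fixed point of \<open>\<phi>\<close> in \<open>V\<close> is sought as the solution of two equations, one for each factor of
  the cylinder: \<open>\<phi>\<close> must preserve the \<open>A\<close>-coordinate and the \<open>[a,b]\<close>-coordinate. The first
  equation is solved along a path that crosses the cylinder, by a fixed point argument with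
  the \<open>[a,b]\<close>-coordinate as a parameter; the second is then solved at some point of that path by
  the intermediate value theorem, because the image under \<open>\<phi>\<close> of a suitable sub-path also
  reaches both ends.

  The space \<open>A\<close> can be arbitrarily large, but the values of \<open>\<phi>\<close> in \<open>M\<close> lie in a compact set
  \<open>K\<close>, which has a copy \<open>e(K)\<close> in the Hilbert cube \<open>Q\<close> (\<open>compact_embeds_hilbert_cube\<close>). Since \<open>A\<close> is
  an absolute retract, the map that takes \<open>e(y)\<close> to the \<open>A\<close>-coordinate of \<open>h(y)\<close> extends to
  \<open>j : Q \<rightarrow> A\<close> (\<open>absolute_retract_extension_hilbert_cube\<close>). Reading the first coordinate of a
  point of \<open>Q\<close> as a parameter and the other coordinates as a point of \<open>Q\<close> again, one obtains a
  map \<open>p : Q \<rightarrow> M\<close>, where \<open>p(q)\<close> has cylinder coordinates \<open>a + (b - a) q\<^sub>0\<close> and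
  \<open>j(q\<^sub>1, q\<^sub>2, \<dots>)\<close>. The points \<open>q\<close> with \<open>p(q) \<in> V\<close> and \<open>\<phi>(p(q)) \<in> M\<close> form a closed set \<open>B\<close>,
  and Tietze's theorem extends \<open>e \<circ> \<phi> \<circ> p\<close> from \<open>B\<close> to a map \<open>u : Q \<rightarrow> Q\<close>. If \<open>q \<in> B\<close> satisfies
  \<open>u(q) = (q\<^sub>1, q\<^sub>2, \<dots>)\<close>, then \<open>\<phi>\<close> preserves the \<open>A\<close>-coordinate of \<open>p(q)\<close>.

  Let \<open>T\<close> be the closed set of those \<open>q \<in> B\<close> for which \<open>\<phi>\<close> preserves the \<open>[a,b]\<close>-coordinate of
  \<open>p(q)\<close>. If no \<open>q \<in> T\<close> satisfied \<open>u(q) = (q\<^sub>1, q\<^sub>2, \<dots>)\<close>, then \<open>Q - T\<close> would be an open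
  neighbourhood of the set of all solutions of this equation. Such a neighbourhood contains a path
  from \<open>q\<^sub>0 = 0\<close> to \<open>q\<^sub>0 = 1\<close> (\<open>hilbert_cube_fixpoint_path\<close>, a form of the
  Leray--Schauder continuation principle). The image of this path under \<open>p\<close> crosses \<open>M\<close>, and
  the crossing hypothesis together with the intermediate value theorem yields a point of \<open>T\<close>
  on the path, a contradiction.
\<close>

section \<open>The Hilbert cube\<close>

definition hilbert_cube :: "(nat \<Rightarrow> real) set" where
  "hilbert_cube = {x. \<forall>i. x i \<in> {0..1}}"

lemma hilbert_cube_bounds: "x \<in> hilbert_cube \<Longrightarrow> 0 \<le> x i" "x \<in> hilbert_cube \<Longrightarrow> x i \<le> 1"
  by (auto simp: hilbert_cube_def)

lemma compact_hilbert_cube: "compact hilbert_cube"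
proof -
  have "hilbert_cube = PiE UNIV (\<lambda>_. {0..1})"
    by (auto simp: hilbert_cube_def PiE_def)
  moreover have "compactin (product_topology (\<lambda>_::nat. euclideanreal) UNIV) (PiE UNIV (\<lambda>_. {0..1}))"
    by (subst compactin_PiE) simp
  ultimately show ?thesis
    by (simp add: euclidean_product_topology)
qed

lemma summable_dist_fun:
  "summable (\<lambda>n. (1/2::real) ^ n * min (dist ((x::nat \<Rightarrow> real) (from_nat n)) (y (from_nat n))) 1)"
  by (rule summable_comparison_test'[of "\<lambda>n. (1/2::real) ^ n"]) auto

text \<open>
  The metric on sequences is a weighted sum of truncated coordinate distances, so it respects
  coordinatewise comparison. This makes its balls star-shaped although the type of sequences
  carries no normed structure.
\<close>

lemma dist_fun_mono:
  fixes x y x' y' :: "nat \<Rightarrow> real"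
  assumes "\<And>i. dist (x i) (y i) \<le> dist (x' i) (y' i)"
  shows "dist x y \<le> dist x' y'"
  unfolding dist_fun_def
  by (rule suminf_le) (auto intro!: mult_left_mono min.coboundedI1 assms summable_dist_fun)

lemma dist_fun_le_uniform:
  fixes x y :: "nat \<Rightarrow> real"
  assumes "\<And>i. dist (x i) (y i) \<le> c"
  shows "dist x y \<le> 2 * c"
proof -
  have *: "(\<lambda>n. (1/2::real) ^ n * c) sums (2 * c)"
    using sums_mult2[OF geometric_sums[of "1/2::real"], of c] by simp
  have "dist x y \<le> (\<Sum>n. (1/2::real) ^ n * c)"
    unfolding dist_fun_def
    by (rule suminf_le) (use * assms in \<open>auto intro!: mult_left_mono min.coboundedI1 summable_dist_fun
      simp: sums_iff\<close>)
  with * show ?thesis by (simp add: sums_iff)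
qed

section \<open>The fixed point property of the Hilbert cube\<close>

text \<open>
  Kuhn's combinatorial lemma works in every dimension \<open>n :: nat\<close>, whereas Brouwer's theorem
  for a Euclidean type has its dimension fixed by the type. The lemma is applied to
  the grid of mesh \<open>1 / p\<close> in the first \<open>n\<close> coordinates (the others are 0), with a vertex labelled
  0 or 1 in direction \<open>i\<close> according to the direction in which \<open>f\<close> moves its \<open>i\<close>-th coordinate. In the
  cell that the lemma provides both labels occur in each direction, so by
  uniform continuity \<open>f\<close> moves none of the first \<open>n\<close> coordinates by much.
\<close>

lemma hilbert_cube_approximate_fixpoint:
  fixes f :: "(nat \<Rightarrow> real) \<Rightarrow> nat \<Rightarrow> real"
  assumes contf: "continuous_on hilbert_cube f" and imf: "f ` hilbert_cube \<subseteq> hilbert_cube" and "\<epsilon> > 0"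
  shows "\<exists>x\<in>hilbert_cube. \<forall>i<n. \<bar>f x i - x i\<bar> \<le> \<epsilon>"
proof -
  have "\<exists>\<delta>>0. \<forall>x\<in>hilbert_cube. \<forall>y\<in>hilbert_cube. dist x y < \<delta> \<longrightarrow> \<bar>f x i - f y i\<bar> < \<epsilon>/2" for i
  proof -
    have "continuous_on hilbert_cube (\<lambda>x. f x i)"
      using contf by (rule continuous_on_product_then_coordinatewise)
    then have "uniformly_continuous_on hilbert_cube (\<lambda>x. f x i)"
      using compact_hilbert_cube compact_uniformly_continuous by blast
    then show ?thesis
      using \<open>\<epsilon> > 0\<close> unfolding uniformly_continuous_on_def
      by (metis dist_commute dist_real_def half_gt_zero)
  qed
  then obtain \<delta> where \<delta>0: "\<And>i. \<delta> i > 0" and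
    \<delta>: "\<And>i x y. x \<in> hilbert_cube \<Longrightarrow> y \<in> hilbert_cube \<Longrightarrow> dist x y < \<delta> i \<Longrightarrow> \<bar>f x i - f y i\<bar> < \<epsilon>/2"
    by metis
  define d where "d = Min (insert (\<epsilon>/2) ((\<lambda>i. \<delta> i / 2) ` {..<n}))"
  have d0: "d > 0" unfolding d_def using \<delta>0 \<open>\<epsilon> > 0\<close> by (subst Min_gr_iff) auto
  have d1: "d \<le> \<epsilon>/2" and d2: "i < n \<Longrightarrow> 2 * d \<le> \<delta> i" for i
  proof -
    show "d \<le> \<epsilon>/2" unfolding d_def by (rule Min_le) auto
    show "2 * d \<le> \<delta> i" if "i < n"
    proof -
      have "d \<le> \<delta> i / 2" unfolding d_def using that by (intro Min_le) auto
      then show ?thesis by simp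
    qed
  qed
  obtain p where p: "p > 0" "1 / real p < d"
    using real_arch_inverse[of d] d0 by (auto simp: inverse_eq_divide)
  define pt where "pt q = (\<lambda>i. if i < n then real (q i) / real p else 0)" for q :: "nat \<Rightarrow> nat"
  \<comment> \<open>On the faces of the grid the labels are forced; this is consistent with
    \<open>f\<close> mapping the cube into itself.\<close>
  define label where
    "label q i = (if q i = p \<or> (q i \<noteq> 0 \<and> f (pt q) i < pt q i) then 1 else 0::nat)"
    for q :: "nat \<Rightarrow> nat" and i
  have ptQ: "pt q \<in> hilbert_cube" if "\<And>i. i < n \<Longrightarrow> q i \<le> p" for q
    using that p by (auto simp: pt_def hilbert_cube_def)
  obtain q where q: "\<forall>i<n. q i < p" and
    alt: "\<forall>i<n. \<exists>r s. (\<forall>j<n. q j \<le> r j \<and> r j \<le> q j + 1) \<and>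
            (\<forall>j<n. q j \<le> s j \<and> s j \<le> q j + 1) \<and> label r i \<noteq> label s i"
    by (rule kuhn_lemma[of p n label]) (use p in \<open>auto simp: label_def\<close>)
  have qQ: "pt q \<in> hilbert_cube" using q by (intro ptQ) auto
  have "\<bar>f (pt q) i - pt q i\<bar> \<le> \<epsilon>" if i: "i < n" for i
  proof -
    have near: "pt r \<in> hilbert_cube \<and> \<bar>f (pt r) i - f (pt q) i\<bar> < \<epsilon>/2 \<and> \<bar>pt r i - pt q i\<bar> \<le> \<epsilon>/2"
      if r: "\<forall>j<n. q j \<le> r j \<and> r j \<le> q j + 1" for r
    proof -
      have rQ: "pt r \<in> hilbert_cube" using r q by (intro ptQ) (metis Suc_eq_plus1 Suc_leI order_trans)
      have close: "dist (pt r j) (pt q j) \<le> 1 / real p" for j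
      proof (cases "j < n")
        case True
        then have "real (q j) \<le> real (r j)" "real (r j) \<le> real (q j) + 1"
          using r by (metis of_nat_le_iff, metis of_nat_le_iff of_nat_Suc Suc_eq_plus1 add.commute)
        then have "\<bar>real (r j) - real (q j)\<bar> / real p \<le> 1 / real p"
          by (intro divide_right_mono) auto
        then show ?thesis using True p
          by (simp add: pt_def dist_real_def flip: diff_divide_distrib)
      qed (simp add: pt_def)
      have "dist (pt r) (pt q) < \<delta> i"
        using dist_fun_le_uniform[of "pt r" "pt q", OF close] p(2) d2[OF i] by simp
      moreover have "\<bar>pt r i - pt q i\<bar> \<le> \<epsilon>/2"
        using close[of i] p(2) d1 by (simp add: dist_real_def)
      ultimately show ?thesis using rQ \<delta>[OF rQ qQ] by auto
    qed
    have lab1: "f (pt r) i \<le> pt r i" if "label r i = 1" "pt r \<in> hilbert_cube" for r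
    proof -
      have "f (pt r) i \<le> 1" using that imf hilbert_cube_bounds by blast
      then show ?thesis using that i p by (auto simp: label_def pt_def split: if_splits)
    qed
    have lab0: "f (pt r) i \<ge> pt r i" if "label r i = 0" "pt r \<in> hilbert_cube" for r
    proof -
      have "f (pt r) i \<ge> 0" using that imf hilbert_cube_bounds by blast
      then show ?thesis using that i p by (auto simp: label_def pt_def split: if_splits)
    qed
    obtain r s where r: "\<forall>j<n. q j \<le> r j \<and> r j \<le> q j + 1"
      and s: "\<forall>j<n. q j \<le> s j \<and> s j \<le> q j + 1" and "label r i \<noteq> label s i"
      using alt i by blast
    moreover have "label t i = 0 \<or> label t i = 1" for t by (simp add: label_def)
    ultimately have "label r i = 0 \<and> label s i = 1 \<or> label r i = 1 \<and> label s i = 0"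
      by metis
    then show ?thesis
      using near[OF r] near[OF s] lab0[of r] lab1[of s] lab0[of s] lab1[of r] by argo
  qed
  with qQ show ?thesis by blast
qed

text \<open>
  Approximate fixed points in more and more coordinates accumulate, by compactness, at an
  exact one.
\<close>

theorem hilbert_cube_fixpoint:
  fixes f :: "(nat \<Rightarrow> real) \<Rightarrow> nat \<Rightarrow> real"
  assumes contf: "continuous_on hilbert_cube f" and imf: "f ` hilbert_cube \<subseteq> hilbert_cube"
  shows "\<exists>x\<in>hilbert_cube. f x = x"
proof -
  have "\<forall>n. \<exists>x\<in>hilbert_cube. \<forall>i<n. \<bar>f x i - x i\<bar> \<le> 1 / real (Suc n)"
    using hilbert_cube_approximate_fixpoint[OF assms] by simp
  then obtain X where XQ: "\<And>n. X n \<in> hilbert_cube"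
    and X: "\<And>n i. i < n \<Longrightarrow> \<bar>f (X n) i - X n i\<bar> \<le> 1 / real (Suc n)"
    by metis
  obtain x r where x: "x \<in> hilbert_cube" and r: "strict_mono r" and lim: "(X \<circ> r) \<longlonglongrightarrow> x"
    using compact_hilbert_cube XQ unfolding compact_def by metis
  have "f x i = x i" for i
  proof -
    have "continuous_on hilbert_cube (\<lambda>x. \<bar>f x i - x i\<bar>)"
      using continuous_on_product_then_coordinatewise[OF contf]
      by (intro continuous_intros continuous_on_subset[OF continuous_on_product_coordinates]) auto
    then have "(\<lambda>n. \<bar>f (X (r n)) i - X (r n) i\<bar>) \<longlonglongrightarrow> \<bar>f x i - x i\<bar>"
      by (rule continuous_on_tendsto_compose) (use lim x XQ in \<open>auto simp: comp_def\<close>)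
    moreover have "(\<lambda>n. 1 / real (Suc (r n))) \<longlonglongrightarrow> 0"
      using LIMSEQ_subseq_LIMSEQ[OF LIMSEQ_Suc[OF lim_1_over_n] r] unfolding comp_def .
    moreover have "\<forall>\<^sub>F n in sequentially. \<bar>f (X (r n)) i - X (r n) i\<bar> \<le> 1 / real (Suc (r n))"
      using eventually_gt_at_top[of i]
      by eventually_elim (meson X seq_suble[OF r] less_le_trans)
    ultimately have "\<bar>f x i - x i\<bar> \<le> 0"
      using tendsto_le[OF sequentially_bot] by blast
    then show ?thesis by simp
  qed
  with x show ?thesis by auto
qed

section \<open>Paths along a parametrized family of fixed points\<close>

lemma path_component_segment:
  fixes x y :: "nat \<Rightarrow> real"
  assumes "\<And>t. t \<in> {0..1} \<Longrightarrow> (\<lambda>i. (1 - t) * x i + t * y i) \<in> U"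
  shows "path_component U x y"
  unfolding path_component_def
proof (intro exI conjI)
  let ?g = "\<lambda>t i. (1 - t) * x i + t * y i"
  show "path ?g" unfolding path_def
    by (intro continuous_on_coordinatewise_then_product continuous_intros)
  show "path_image ?g \<subseteq> U" using assms by (auto simp: path_image_def)
qed (auto simp: pathstart_def pathfinish_def)

lemma hilbert_cube_locally_path_connected:
  assumes "openin (top_of_set hilbert_cube) U" "x \<in> U"
  obtains e where "e > 0" "\<And>y. y \<in> hilbert_cube \<Longrightarrow> dist y x < e \<Longrightarrow> path_component U x y"
proof -
  obtain e where e: "e > 0" "\<And>y. y \<in> hilbert_cube \<Longrightarrow> dist y x < e \<Longrightarrow> y \<in> U" and UQ: "U \<subseteq> hilbert_cube"
    using assms unfolding openin_euclidean_subtopology_iff by metis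
  have "path_component U x y" if y: "y \<in> hilbert_cube" "dist y x < e" for y
  proof (rule path_component_segment)
    fix t :: real assume t: "t \<in> {0..1}"
    let ?z = "\<lambda>i. (1 - t) * x i + t * y i"
    have xQ: "x \<in> hilbert_cube" using assms UQ by blast
    have "?z \<in> hilbert_cube"
      using t hilbert_cube_bounds[OF xQ] hilbert_cube_bounds[OF y(1)]
      by (auto simp: hilbert_cube_def intro!: convex_bound_le)
    moreover have "dist ?z x \<le> dist y x"
    proof (rule dist_fun_mono)
      fix i
      have "?z i - x i = t * (y i - x i)" by (simp add: algebra_simps)
      then have "\<bar>?z i - x i\<bar> = t * \<bar>y i - x i\<bar>" using t by (simp add: abs_mult)
      also have "\<dots> \<le> 1 * \<bar>y i - x i\<bar>" using t by (intro mult_right_mono) auto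
      finally show "dist (?z i) (x i) \<le> dist (y i) (x i)" by (simp add: dist_real_def)
    qed
    ultimately show "?z \<in> U" using e y by auto
  qed
  with e that show thesis by blast
qed

text \<open>
  The first coordinate of a point of the cube serves as a parameter \<open>s\<close> and the remaining ones
  as a point \<open>w\<close> of the cube, so that \<open>G x = x \<circ> Suc\<close> says that \<open>w\<close> is a fixed point of \<open>G(s, \<cdot>)\<close>.
  If no path in \<open>U\<close> joins \<open>s = 0\<close> to \<open>s = 1\<close>, then the solutions split into two closed sets:
  those reachable in \<open>U\<close> from \<open>s = 0\<close>, and the others. A function \<open>\<mu>\<close> equal to 1 on the former
  and to 0 on the latter gives a self-map \<open>(s, w) \<mapsto> (\<mu>(s, w), G(s, w))\<close> of the cube without
  fixed point, against \<open>hilbert_cube_fixpoint\<close>: a fixed point would be a solution with \<open>s = \<mu>\<close>, hence reachable and at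
  \<open>s = 1\<close>, or unreachable and at \<open>s = 0\<close>.
\<close>

lemma hilbert_cube_fixpoint_path:
  fixes G :: "(nat \<Rightarrow> real) \<Rightarrow> nat \<Rightarrow> real"
  assumes contG: "continuous_on hilbert_cube G" and imG: "G ` hilbert_cube \<subseteq> hilbert_cube"
    and U: "openin (top_of_set hilbert_cube) U"
    and fixU: "\<And>x. x \<in> hilbert_cube \<Longrightarrow> G x = x \<circ> Suc \<Longrightarrow> x \<in> U"
  shows "\<exists>x y. path_component U x y \<and> x 0 = 0 \<and> y 0 = 1"
proof (rule ccontr)
  assume no_path: "\<not> ?thesis"
  define S where "S = {x \<in> hilbert_cube. G x = x \<circ> Suc}"
  define P where "P = {y. \<exists>x. path_component U x y \<and> x 0 = 0}"
  have PU: "P \<subseteq> U" unfolding P_def using path_component_mem by blast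
  have UQ: "U \<subseteq> hilbert_cube" using U openin_imp_subset by blast
  have openP: "openin (top_of_set hilbert_cube) P" and openUP: "openin (top_of_set hilbert_cube) (U - P)"
    unfolding openin_euclidean_subtopology_iff
  proof safe
    fix x assume "x \<in> P"
    then obtain e where e: "e > 0" "\<And>y. y \<in> hilbert_cube \<Longrightarrow> dist y x < e \<Longrightarrow> path_component U x y"
      using hilbert_cube_locally_path_connected[OF U] PU by blast
    then have "\<forall>y\<in>hilbert_cube. dist y x < e \<longrightarrow> y \<in> P"
      using \<open>x \<in> P\<close> unfolding P_def by (blast intro: path_component_trans)
    with e show "\<exists>e>0. \<forall>y\<in>hilbert_cube. dist y x < e \<longrightarrow> y \<in> P" by blast
  next
    fix x assume "x \<in> U" "x \<notin> P"
    then obtain e where e: "e > 0" "\<And>y. y \<in> hilbert_cube \<Longrightarrow> dist y x < e \<Longrightarrow> path_component U x y"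
      using hilbert_cube_locally_path_connected[OF U] by blast
    then have "\<forall>y\<in>hilbert_cube. dist y x < e \<longrightarrow> y \<in> U - P"
      using \<open>x \<notin> P\<close> unfolding P_def
      by (blast intro: path_component_trans path_component_sym dest: path_component_mem)
    with e show "\<exists>e>0. \<forall>y\<in>hilbert_cube. dist y x < e \<longrightarrow> y \<in> U - P" by blast
  qed (use PU UQ in auto)
  have closedS: "closedin (top_of_set hilbert_cube) S"
  proof -
    have "continuous_on hilbert_cube (\<lambda>x. (\<lambda>i. G x i - x (Suc i)))"
      using continuous_on_product_then_coordinatewise[OF contG]
      by (intro continuous_on_coordinatewise_then_product continuous_on_diff
            continuous_on_subset[OF continuous_on_product_coordinates]) auto
    moreover have "S = hilbert_cube \<inter> (\<lambda>x. (\<lambda>i. G x i - x (Suc i))) -` {\<lambda>i. 0}"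
      by (auto simp: S_def fun_eq_iff)
    ultimately show ?thesis
      using continuous_closedin_preimage closed_singleton by (metis (lifting))
  qed
  have "closedin (top_of_set hilbert_cube) (S - P)" "closedin (top_of_set hilbert_cube) (S - (U - P))"
    using closedS openP openUP by (auto intro: closedin_diff)
  moreover have "normal_space (top_of_set hilbert_cube)"
    by (intro metrizable_imp_normal_space metrizable_space_subtopology metrizable_space_euclidean)
  moreover have "disjnt (S - P) (S - (U - P))"
    using fixU by (auto simp: disjnt_def S_def)
  ultimately have "\<exists>\<mu>. continuous_map (top_of_set hilbert_cube) (top_of_set {0..1::real}) \<mu> \<and>
      \<mu> ` (S - P) \<subseteq> {0} \<and> \<mu> ` (S - (U - P)) \<subseteq> {1}"
    by (metis Urysohn_lemma zero_le_one)
  then obtain \<mu> where cont\<mu>: "continuous_map (top_of_set hilbert_cube) (top_of_set {0..1::real}) \<mu>"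
    and \<mu>0: "\<mu> ` (S - P) \<subseteq> {0}" and \<mu>1: "\<mu> ` (S - (U - P)) \<subseteq> {1}"
    by blast
  have cont\<mu>': "continuous_on hilbert_cube \<mu>" and \<mu>I: "\<And>x. x \<in> hilbert_cube \<Longrightarrow> \<mu> x \<in> {0..1}"
    using cont\<mu> by (auto simp: continuous_map_in_subtopology)
  \<comment> \<open>\<open>case_nat c w\<close> is the sequence with first term \<open>c\<close> followed by \<open>w\<close>.\<close>
  have "continuous_on hilbert_cube (\<lambda>x. case_nat (\<mu> x) (G x))"
  proof (rule continuous_on_coordinatewise_then_product)
    show "continuous_on hilbert_cube (\<lambda>x. case_nat (\<mu> x) (G x) i)" for i
      using cont\<mu>' continuous_on_product_then_coordinatewise[OF contG] by (cases i) auto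
  qed
  moreover have "(\<lambda>x. case_nat (\<mu> x) (G x)) ` hilbert_cube \<subseteq> hilbert_cube"
  proof -
    have "case_nat (\<mu> x) (G x) i \<in> {0..1}" if "x \<in> hilbert_cube" for x i
      using \<mu>I[OF that] imG that by (cases i) (auto simp: hilbert_cube_def)
    then show ?thesis by (auto simp: hilbert_cube_def)
  qed
  ultimately obtain x where x: "x \<in> hilbert_cube" "case_nat (\<mu> x) (G x) = x"
    using hilbert_cube_fixpoint by blast
  then have x0: "x 0 = \<mu> x" and "x \<circ> Suc = G x"
    by (metis nat.case(1), metis (no_types) comp_apply ext nat.case(2))
  then have xS: "x \<in> S" and xU: "x \<in> U" using x fixU by (auto simp: S_def)
  show False
  proof (cases "x \<in> P")
    case True
    then have "x 0 = 1" using \<mu>1 xS x0 by auto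
    with True no_path show False unfolding P_def by blast
  next
    case False
    then have "x 0 = 0" using \<mu>0 xS x0 by auto
    with False xU show False unfolding P_def using path_component_refl by blast
  qed
qed

section \<open>Compact sets in the Hilbert cube\<close>

text \<open>
  The distances to the points of a countable dense set, truncated at 1, separate the points of
  the compact set.
\<close>

lemma compact_embeds_hilbert_cube:
  fixes K :: "'y::metric_space set"
  assumes "compact K"
  obtains e where "continuous_on K e" "inj_on e K" "e ` K \<subseteq> hilbert_cube"
proof -
  have "\<exists>D. finite D \<and> K \<subseteq> (\<Union>x\<in>D. ball x (1 / real (Suc n)))" for n
    using assms by (simp add: compact_eq_totally_bounded)
  then obtain D where D: "\<And>n. finite (D n)" "\<And>n. K \<subseteq> (\<Union>x\<in>D n. ball x (1 / real (Suc n)))"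
    by metis
  \<comment> \<open>If \<open>K\<close> is empty, the points \<open>d n\<close> are arbitrary.\<close>
  define d where "d = from_nat_into (\<Union>n. D n)"
  define e where "e x n = min 1 (dist x (d n))" for x n
  have "continuous_on K e"
    unfolding e_def by (intro continuous_on_coordinatewise_then_product continuous_intros)
  moreover have "inj_on e K"
  proof (rule inj_onI, rule ccontr)
    fix x y assume xy: "x \<in> K" "y \<in> K" "e x = e y" "x \<noteq> y"
    define r where "r = min 1 (dist x y / 2)"
    have "r > 0" using xy by (simp add: r_def)
    then obtain n where n: "1 / real (Suc n) < r" by (rule nat_approx_posE)
    obtain z where z: "z \<in> D n" "dist z x < 1 / real (Suc n)" using D(2)[of n] xy by auto
    have "countable (\<Union>n. D n)" using D(1) by (auto intro: countable_finite)
    then obtain m where m: "d m = z"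
      unfolding d_def using z(1) from_nat_into_surj by (metis UN_I UNIV_I)
    have "dist x z < r" using z n by (simp add: dist_commute)
    moreover have "min 1 (dist x z) = min 1 (dist y z)"
      using xy(3) m unfolding e_def by metis
    moreover have "r \<le> 1" by (simp add: r_def)
    ultimately have "dist x z < r" "dist y z < r" by (auto simp: min_def split: if_splits)
    then have "dist x y < 2 * r" using dist_triangle2[of x y z] by simp
    then show False by (simp add: r_def)
  qed
  moreover have "e ` K \<subseteq> hilbert_cube" by (auto simp: e_def hilbert_cube_def)
  ultimately show thesis using that by blast
qed

section \<open>Extending maps into an absolute retract\<close>

text \<open>
  A real sequence is determined by the rational numbers below its terms, that is, by a set of
  natural numbers. The cardinality matters because the definition of an absolute retract tests
  only topologies on the type \<open>'a \<Rightarrow> real\<close>: the constant functions alone make room in this type for a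
  copy of the Hilbert cube, whatever the type \<open>'a\<close> is.
\<close>

lemma inj_real_sequences_into_reals: "\<exists>c :: (nat \<Rightarrow> real) \<Rightarrow> real. inj c"
proof -
  define L where "L x = {prod_encode (n, k) | n k. of_rat (from_nat k) < x n}" for x :: "nat \<Rightarrow> real"
  have mem: "prod_encode (n, k) \<in> L x \<longleftrightarrow> of_rat (from_nat k) < x n" for n k x
    by (auto simp: L_def)
  have le: "x n \<le> y n" if "L x = L y" for x y n
  proof (rule ccontr)
    assume "\<not> x n \<le> y n"
    then obtain q where q: "y n < of_rat q" "of_rat q < x n" using of_rat_dense[of "y n" "x n"] by auto
    have "from_nat (to_nat q) = q" by simp
    with q mem[of n "to_nat q" x] mem[of n "to_nat q" y] that show False by simp
  qed
  have "inj L" by (intro injI ext antisym le) auto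
  moreover obtain c :: "nat set \<Rightarrow> real" where "inj c"
    using nat_sets_lepoll_reals01 unfolding lepoll_def by blast
  ultimately show ?thesis using inj_compose by blast
qed

text \<open>
  Transporting the topology of \<open>X\<close> along the injection \<open>c\<close> gives a homeomorphic copy of \<open>X\<close> on
  the type \<open>'a \<Rightarrow> real\<close>, to which the defining property of \<open>A\<close> applies.
\<close>

lemma absolute_retract_extension:
  fixes A :: "'a topology" and X :: "'z topology" and c :: "'z \<Rightarrow> 'a \<Rightarrow> real"
  assumes A: "absolute_retract A" and X: "metrizable_space X" and c: "inj_on c (topspace X)"
    and F: "closedin X F" and f: "continuous_map (subtopology X F) A f"
  obtains g where "continuous_map X A g" "\<And>x. x \<in> F \<Longrightarrow> g x = f x"
proof -
  define c' where "c' = inv_into (topspace X) c"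
  define Z where "Z = pullback_topology (c ` topspace X) c' X"
  have c'c: "c' (c x) = x" if "x \<in> topspace X" for x
    using that c by (simp add: c'_def)
  have tZ: "topspace Z = c ` topspace X"
    unfolding Z_def topspace_pullback_topology using c'c by auto
  have contc': "continuous_map Z X c'"
    using continuous_map_pullback[OF continuous_map_id] unfolding Z_def by simp
  have contc: "continuous_map X Z c" unfolding Z_def
  proof (rule continuous_map_pullback')
    show "continuous_map X X (c' \<circ> c)"
      using continuous_map_id by (rule continuous_map_eq) (simp add: c'c)
  qed auto
  have hom: "homeomorphic_maps X Z c c'"
    unfolding homeomorphic_maps_def using contc contc' tZ c'c by auto
  have "metrizable_space Z"
    using X hom homeomorphic_metrizable_space homeomorphic_space_def by blast
  moreover have "closedin Z (c ` F)"
    using F hom homeomorphic_map_closedness_eq homeomorphic_map_maps by metis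
  moreover have "continuous_map (subtopology Z (c ` F)) A (f \<circ> c')"
  proof (rule continuous_map_compose[OF _ f])
    show "continuous_map (subtopology Z (c ` F)) (subtopology X F) c'"
      using contc' closedin_subset[OF F] c'c
      by (auto simp: continuous_map_in_subtopology continuous_map_from_subtopology)
  qed
  ultimately obtain g where g: "continuous_map Z A g" "\<forall>x\<in>c ` F. g x = (f \<circ> c') x"
    using A unfolding absolute_retract_def by blast
  show thesis
  proof
    show "continuous_map X A (g \<circ> c)" using contc g(1) by (rule continuous_map_compose)
    show "(g \<circ> c) x = f x" if "x \<in> F" for x
      using that g(2) c'c closedin_subset[OF F] by auto
  qed
qed

lemma absolute_retract_extension_hilbert_cube:
  fixes A :: "'a topology"
  assumes "absolute_retract A" "closedin (top_of_set hilbert_cube) F"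
    and "continuous_map (top_of_set F) A f"
  obtains g where "continuous_map (top_of_set hilbert_cube) A g" "\<And>x. x \<in> F \<Longrightarrow> g x = f x"
proof -
  obtain c :: "(nat \<Rightarrow> real) \<Rightarrow> real" where "inj c" using inj_real_sequences_into_reals by blast
  then have "inj (\<lambda>x (_::'a). c x)" by (auto simp: inj_on_def fun_eq_iff)
  moreover have "subtopology (top_of_set hilbert_cube) F = top_of_set F"
    using assms(2) closedin_subset by (fastforce simp: subtopology_subtopology inf_absorb2)
  ultimately show thesis
    using that absolute_retract_extension[of A "top_of_set hilbert_cube" "\<lambda>x _. c x" F f] assms
    by (auto intro: metrizable_space_subtopology metrizable_space_euclidean inj_on_subset)
qed

text \<open>
  The cube is a product of intervals, so Tietze's theorem can be applied in each coordinate.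
\<close>

lemma Tietze_hilbert_cube:
  fixes f :: "(nat \<Rightarrow> real) \<Rightarrow> nat \<Rightarrow> real"
  assumes B: "closedin (top_of_set hilbert_cube) B" and contf: "continuous_on B f" and imf: "f ` B \<subseteq> hilbert_cube"
  obtains u where "continuous_on hilbert_cube u" "u ` hilbert_cube \<subseteq> hilbert_cube" "\<And>x. x \<in> B \<Longrightarrow> u x = f x"
proof -
  have norm: "normal_space (top_of_set hilbert_cube)"
    by (intro metrizable_imp_normal_space metrizable_space_subtopology metrizable_space_euclidean)
  have sub: "subtopology (top_of_set hilbert_cube) B = top_of_set B"
    using B closedin_subset by (fastforce simp: subtopology_subtopology inf_absorb2)
  have "\<exists>g. continuous_on hilbert_cube g \<and> (\<forall>x\<in>B. g x = f x n) \<and> g ` hilbert_cube \<subseteq> {0..1}" for n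
  proof -
    have "continuous_on B (\<lambda>x. f x n)" using contf by (rule continuous_on_product_then_coordinatewise)
    moreover have "(\<lambda>x. f x n) ` B \<subseteq> {0..1}" using imf by (auto simp: hilbert_cube_def)
    ultimately obtain g where "continuous_map (top_of_set hilbert_cube) euclideanreal g"
      "\<And>x. x \<in> B \<Longrightarrow> g x = f x n" "g ` topspace (top_of_set hilbert_cube) \<subseteq> {0..1}"
      using Tietze_extension_closed_real_interval[OF norm B, of "\<lambda>x. f x n" 0 1] sub
      by (metis continuous_map_iff_continuous zero_le_one)
    then show ?thesis by (intro exI[of _ g]) auto
  qed
  then obtain g where g: "\<And>n. continuous_on hilbert_cube (g n)" "\<And>n x. x \<in> B \<Longrightarrow> g n x = f x n"
    "\<And>n. g n ` hilbert_cube \<subseteq> {0..1}" by metis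
  show thesis
  proof
    show "continuous_on hilbert_cube (\<lambda>x n. g n x)"
      using g(1) by (rule continuous_on_coordinatewise_then_product)
    show "(\<lambda>x n. g n x) ` hilbert_cube \<subseteq> hilbert_cube"
      using g(3) by (auto simp: hilbert_cube_def image_subset_iff)
  qed (use g(2) in auto)
qed

section \<open>Fixed points of maps that stretch paths across a cylinder\<close>

theorem corollary2p2:
  fixes M N V M\<^sub>l M\<^sub>r :: "'y::metric_space set"
    and A :: "'a topology"
    and a b :: real
    and h :: "'y \<Rightarrow> real \<times> 'a"
    and \<phi> :: "'y \<Rightarrow> 'y"
  assumes "absolute_retract A"
    and "a < b"
    and "closed M"
    and "homeomorphic_map (top_of_set M) (prod_topology (top_of_set {a..b}) A) h"
    and "M\<^sub>l = M \<inter> h -` ({a} \<times> topspace A)"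
    and "M\<^sub>r = M \<inter> h -` ({b} \<times> topspace A)"
    and "closed V"
    and "V \<subseteq> M \<inter> N"
    and "compact_map_on V \<phi>"
    and "\<And>(\<sigma> :: real \<Rightarrow> 'y) s t.
           \<lbrakk>s \<le> t; continuous_on {s..t} \<sigma>; \<sigma> ` {s..t} \<subseteq> M;
            \<sigma> ` {s..t} \<inter> M\<^sub>l \<noteq> {}; \<sigma> ` {s..t} \<inter> M\<^sub>r \<noteq> {}\<rbrakk> \<Longrightarrow>
           \<exists>s\<^sub>0 s\<^sub>1. s \<le> s\<^sub>0 \<and> s\<^sub>0 \<le> s\<^sub>1 \<and> s\<^sub>1 \<le> t \<and> \<sigma> ` {s\<^sub>0..s\<^sub>1} \<subseteq> V \<and>
             \<phi> ` \<sigma> ` {s\<^sub>0..s\<^sub>1} \<subseteq> M \<and>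
             \<phi> ` \<sigma> ` {s\<^sub>0..s\<^sub>1} \<inter> M\<^sub>l \<noteq> {} \<and>
             \<phi> ` \<sigma> ` {s\<^sub>0..s\<^sub>1} \<inter> M\<^sub>r \<noteq> {}"
  shows "\<exists>z\<in>V. \<phi> z = z"
proof -
  define C where "C = prod_topology (top_of_set {a..b}) A"
  obtain k where hom: "homeomorphic_maps (top_of_set M) C h k"
    using assms(4) unfolding C_def homeomorphic_map_maps by blast
  have conth: "continuous_map (top_of_set M) C h" and contk: "continuous_map C (top_of_set M) k"
    and kh: "\<And>y. y \<in> M \<Longrightarrow> k (h y) = y" and hk: "\<And>z. z \<in> topspace C \<Longrightarrow> h (k z) = z"
    using hom by (auto simp: homeomorphic_maps_def)
  have topC: "topspace C = {a..b} \<times> topspace A" by (simp add: C_def)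
  have hC: "h y \<in> {a..b} \<times> topspace A" if "y \<in> M" for y
    using continuous_map_image_subset_topspace[OF conth] that topC by auto
  have kM: "k z \<in> M" if "z \<in> topspace C" for z
    using continuous_map_image_subset_topspace[OF contk] that by auto
  have conth1: "continuous_on M (\<lambda>y. fst (h y))"
    using continuous_map_compose[OF conth[unfolded C_def] continuous_map_fst]
    by (simp add: continuous_map_in_subtopology comp_def)
  have conth2: "continuous_map (top_of_set M) A (\<lambda>y. snd (h y))"
    using continuous_map_compose[OF conth[unfolded C_def] continuous_map_snd] by (simp add: comp_def)
  have cont\<phi>: "continuous_on V \<phi>" and VM: "V \<subseteq> M"
    using assms(8,9) by (auto simp: compact_map_on_def)

  \<comment> \<open>The compact set \<open>K\<close> contains all values of \<open>\<phi>\<close> on \<open>V\<close> that lie in \<open>M\<close>. Its copy \<open>e ` K\<close> in the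
    Hilbert cube replaces the possibly non-compact factor \<open>A\<close>.\<close>
  define K where "K = closure (\<phi> ` V) \<inter> M"
  have compK: "compact K"
    using assms(3,9) unfolding K_def compact_map_on_def by (simp add: compact_Int_closed)
  have \<phi>K: "\<phi> y \<in> K" if "y \<in> V" "\<phi> y \<in> M" for y
    using that closure_subset[of "\<phi> ` V"] by (auto simp: K_def)
  obtain e where conte: "continuous_on K e" and inje: "inj_on e K" and eQ: "e ` K \<subseteq> hilbert_cube"
    using compact_embeds_hilbert_cube[OF compK] by blast
  have closedeK: "closedin (top_of_set hilbert_cube) (e ` K)"
    using compact_continuous_image[OF conte compK] eQ by (simp add: closed_subset compact_imp_closed)
  have conte': "continuous_on (e ` K) (inv_into K e)"
    using conte compK inje by (intro continuous_on_inv) auto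
  have "continuous_map (top_of_set (e ` K)) (top_of_set M) (inv_into K e)"
    using conte' inje by (auto simp: continuous_map_in_subtopology K_def)
  from continuous_map_compose[OF this conth2]
  have "continuous_map (top_of_set (e ` K)) A (\<lambda>x. snd (h (inv_into K e x)))"
    by (simp add: comp_def)
  from absolute_retract_extension_hilbert_cube[OF assms(1) closedeK this]
  obtain j where contj: "continuous_map (top_of_set hilbert_cube) A j"
    and j: "\<And>x. x \<in> e ` K \<Longrightarrow> j x = snd (h (inv_into K e x))"
    by blast
  have je: "j (e y) = snd (h y)" if "y \<in> K" for y
    using j[of "e y"] that inje by simp

  \<comment> \<open>A point of the cube encodes a point of the cylinder: its first coordinate gives the position
    between \<open>a\<close> and \<open>b\<close>, and \<open>j\<close> applied to the rest gives the position in \<open>A\<close>.\<close>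
  define z where "z q = (a + (b - a) * q 0, j (q \<circ> Suc))" for q
  define p where "p q = k (z q)" for q
  have tlQ: "q \<circ> Suc \<in> hilbert_cube" if "q \<in> hilbert_cube" for q
    using that by (auto simp: hilbert_cube_def)
  have contz: "continuous_map (top_of_set hilbert_cube) C z"
    unfolding C_def z_def
  proof (rule continuous_map_pairedI)
    have "continuous_on hilbert_cube (\<lambda>q. a + (b - a) * q 0)"
      by (intro continuous_intros continuous_on_subset[OF continuous_on_product_coordinates]) auto
    moreover have "a + (b - a) * q 0 \<in> {a..b}" if "q \<in> hilbert_cube" for q
    proof -
      have "(b - a) * q 0 \<le> (b - a) * 1" "0 \<le> (b - a) * q 0"
        using assms(2) hilbert_cube_bounds[OF that, of 0] by (auto intro: mult_left_mono)
      then show ?thesis by simp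
    qed
    ultimately show "continuous_map (top_of_set hilbert_cube) (top_of_set {a..b}) (\<lambda>q. a + (b - a) * q 0)"
      by (auto simp: continuous_map_in_subtopology)
    have "continuous_on hilbert_cube (\<lambda>q. q \<circ> Suc)"
      unfolding comp_def
      by (intro continuous_on_coordinatewise_then_product
            continuous_on_subset[OF continuous_on_product_coordinates]) auto
    then have "continuous_map (top_of_set hilbert_cube) (top_of_set hilbert_cube) (\<lambda>q. q \<circ> Suc)"
      using tlQ by (auto simp: continuous_map_in_subtopology)
    from continuous_map_compose[OF this contj]
    show "continuous_map (top_of_set hilbert_cube) A (\<lambda>q. j (q \<circ> Suc))" by (simp add: comp_def)
  qed
  have zC: "z q \<in> topspace C" if "q \<in> hilbert_cube" for q
    using continuous_map_image_subset_topspace[OF contz] that by auto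
  have contp: "continuous_on hilbert_cube p" and pM: "p ` hilbert_cube \<subseteq> M"
    using continuous_map_compose[OF contz contk]
    by (auto simp: p_def comp_def continuous_map_in_subtopology)
  have hp: "h (p q) = z q" if "q \<in> hilbert_cube" for q
    unfolding p_def using zC[OF that] by (rule hk)

  \<comment> \<open>On \<open>B\<close> the displacement of the encoded point by \<open>\<phi>\<close> can be measured in the cylinder. Only
    there is the extension \<open>u\<close> related to \<open>\<phi>\<close>.\<close>
  define W where "W = V \<inter> \<phi> -` M"
  define B where "B = hilbert_cube \<inter> p -` W"
  have "closed W"
    unfolding W_def using cont\<phi> assms(7,3) by (rule continuous_closed_preimage)
  then have closedB: "closedin (top_of_set hilbert_cube) B"
    unfolding B_def using contp by (intro continuous_closedin_preimage)
  have BQ: "B \<subseteq> hilbert_cube" by (auto simp: B_def)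
  have cont\<phi>p: "continuous_on B (\<lambda>q. \<phi> (p q))"
    by (rule continuous_on_compose2[OF cont\<phi> continuous_on_subset[OF contp BQ]]) (auto simp: B_def W_def)
  have "continuous_on B (\<lambda>q. e (\<phi> (p q)))"
    by (rule continuous_on_compose2[OF conte cont\<phi>p]) (auto simp: B_def W_def \<phi>K)
  moreover have "(\<lambda>q. e (\<phi> (p q))) ` B \<subseteq> hilbert_cube"
    using eQ \<phi>K by (auto simp: B_def W_def)
  ultimately obtain u where contu: "continuous_on hilbert_cube u" and uQ: "u ` hilbert_cube \<subseteq> hilbert_cube"
    and u: "\<And>q. q \<in> B \<Longrightarrow> u q = e (\<phi> (p q))"
    using Tietze_hilbert_cube[OF closedB] by blast

  \<comment> \<open>\<open>D\<close> is the displacement in the direction of \<open>[a,b]\<close>.\<close>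
  define D where "D q = fst (h (\<phi> (p q))) - (a + (b - a) * q 0)" for q
  define T where "T = B \<inter> D -` {0}"
  have contD: "continuous_on B D"
    unfolding D_def
    by (intro continuous_intros continuous_on_subset[OF continuous_on_product_coordinates]
          continuous_on_compose2[OF conth1 cont\<phi>p]) (auto simp: B_def W_def)
  have closedT: "closedin (top_of_set hilbert_cube) T"
  proof -
    have "closedin (top_of_set B) T"
      unfolding T_def using contD by (intro continuous_closedin_preimage) auto
    then show ?thesis using closedB closedin_trans by blast
  qed

  have "\<exists>q\<in>T. u q = q \<circ> Suc"
  proof (rule ccontr)
    assume none: "\<not> ?thesis"
    define U where "U = hilbert_cube - T"
    have "openin (top_of_set hilbert_cube) U"
      unfolding U_def using closedT by (metis openin_diff openin_topspace topspace_euclidean_subtopology)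
    then obtain x y where xy: "path_component U x y" "x 0 = 0" "y 0 = 1"
      using hilbert_cube_fixpoint_path[OF contu uQ, of U] none unfolding U_def by blast
    then obtain g where g: "continuous_on {0..1::real} g" "g ` {0..1} \<subseteq> U" "g 0 = x" "g 1 = y"
      unfolding path_component_def path_def path_image_def pathstart_def pathfinish_def by blast
    have gQ: "g t \<in> hilbert_cube" if "t \<in> {0..1}" for t using g(2) that unfolding U_def by blast
    define \<sigma> where "\<sigma> t = p (g t)" for t
    have cont\<sigma>: "continuous_on {0..1} \<sigma>"
      unfolding \<sigma>_def by (rule continuous_on_compose2[OF contp g(1)]) (use gQ in auto)
    have \<sigma>M: "\<sigma> ` {0..1} \<subseteq> M" using pM gQ by (auto simp: \<sigma>_def)
    have h\<sigma>: "h (\<sigma> t) = z (g t)" if "t \<in> {0..1}" for t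
      using hp gQ that by (simp add: \<sigma>_def)
    have "h (\<sigma> 0) \<in> {a} \<times> topspace A" "h (\<sigma> 1) \<in> {b} \<times> topspace A"
      using h\<sigma>[of 0] h\<sigma>[of 1] xy g zC[OF gQ[of 0]] zC[OF gQ[of 1]] topC by (auto simp: z_def)
    then have "\<sigma> 0 \<in> M\<^sub>l" "\<sigma> 1 \<in> M\<^sub>r" using \<sigma>M assms(5,6) by auto
    moreover have "\<sigma> 0 \<in> \<sigma> ` {0..1}" "\<sigma> 1 \<in> \<sigma> ` {0..1}" by (intro imageI; simp)+
    ultimately have "\<sigma> ` {0..1} \<inter> M\<^sub>l \<noteq> {}" "\<sigma> ` {0..1} \<inter> M\<^sub>r \<noteq> {}" by blast+
    from assms(10)[OF zero_le_one cont\<sigma> \<sigma>M this]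
    obtain s0 s1 where s: "0 \<le> s0" "s0 \<le> s1" "s1 \<le> 1" "\<sigma> ` {s0..s1} \<subseteq> V" "\<phi> ` \<sigma> ` {s0..s1} \<subseteq> M"
      "\<phi> ` \<sigma> ` {s0..s1} \<inter> M\<^sub>l \<noteq> {}" "\<phi> ` \<sigma> ` {s0..s1} \<inter> M\<^sub>r \<noteq> {}" by blast
    have gB: "g t \<in> B" if "t \<in> {s0..s1}" for t
      using s that gQ[of t] by (auto simp: B_def W_def \<sigma>_def image_subset_iff)
    obtain t0 t1 where t: "t0 \<in> {s0..s1}" "\<phi> (\<sigma> t0) \<in> M\<^sub>l" "t1 \<in> {s0..s1}" "\<phi> (\<sigma> t1) \<in> M\<^sub>r"
      using s(6,7) by blast
    \<comment> \<open>An image point on the left end can only have moved to the left, one on the right end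
      only to the right; so \<open>D\<close> changes sign along the sub-path.\<close>
    have "a + (b - a) * g t 0 \<in> {a..b}" if "t \<in> {s0..s1}" for t
      using zC[OF gQ, of t] that s topC by (simp add: z_def)
    then have D01: "D (g t0) \<le> 0" "0 \<le> D (g t1)"
      using t assms(5,6) by (auto simp: D_def \<sigma>_def)
    have "connected ((\<lambda>t. D (g t)) ` {s0..s1})"
    proof (rule connected_continuous_image)
      have "continuous_on {s0..s1} g" using g(1) s by (auto intro: continuous_on_subset)
      then show "continuous_on {s0..s1} (\<lambda>t. D (g t))"
        by (rule continuous_on_compose2[OF contD]) (use gB in auto)
    qed auto
    then have "0 \<in> (\<lambda>t. D (g t)) ` {s0..s1}"
      using D01 t connectedD_interval by blast
    then obtain t where "t \<in> {s0..s1}" "D (g t) = 0" by force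
    then have "g t \<in> T" "t \<in> {0..1}" using gB s by (auto simp: T_def)
    then show False using g(2) unfolding U_def by blast
  qed
  then obtain q where q: "q \<in> B" "D q = 0" "u q = q \<circ> Suc" by (auto simp: T_def)
  then have pq: "p q \<in> V" "\<phi> (p q) \<in> M" "q \<in> hilbert_cube" by (auto simp: B_def W_def)
  \<comment> \<open>The \<open>A\<close>-coordinate is preserved because \<open>j\<close> undoes \<open>e\<close> up to \<open>snd \<circ> h\<close>.\<close>
  have "fst (h (\<phi> (p q))) = fst (z q)" using q(2) by (simp add: D_def z_def)
  moreover have "snd (h (\<phi> (p q))) = snd (z q)"
    using je[OF \<phi>K[OF pq(1,2)]] u[OF q(1)] q(3) by (simp add: z_def)
  ultimately have "h (\<phi> (p q)) = h (p q)" using hp[OF pq(3)] by (simp add: prod_eq_iff)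
  then have "\<phi> (p q) = p q" using kh pq VM by (metis subsetD)
  with pq(1) show ?thesis by blast
qed

end
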